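(* There exists an infinite sequence of integers $S=\{n_k : k \ge 1\}$ satisfying $n_1=2$ and, for all $k\ge 2$, $$2^{\frac{1}{14}(n_{k-1}+2k-7)} \le n_k \le 2^{27(n_{k-1}+2k+6)},$$ having the following property: the set $\Sigma(S)$ of all real numbers $\lambda>0$ such that, for every $n \in S$, the integer $\lfloor \lambda 2^{n}\rfloor$ has a ternary expansion omitting the digit $2$, is an uncountable set.
   Context: The ternary expansion of a nonnegative integer is its base 3 digit expansion with digits in $\{0,1,2\}$; it "omits the digit 2" if every digit is $0$ or $1$. $\lfloor x\rfloor$ is the floor of the real number $x$. *)

theory Defs
  imports Complex_Main "HOL-Library.Countable_Set"
begin

(* The digit at position j (weight 3^j) of the base 3 expansion of a nonnegative integer m;
   it is 0 at all positions beyond the leading one. *)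
definition ternary_digit :: "int \<Rightarrow> nat \<Rightarrow> int"
  where "ternary_digit m j = m div 3 ^ j mod 3"

lemma ternary_digit_range: "ternary_digit m j \<in> {0, 1, 2}"
  unfolding ternary_digit_def by auto

lemma ternary_expansion:
  assumes "0 \<le> m" and "m < 3 ^ N"
  shows "m = (\<Sum>j<N. ternary_digit m j * 3 ^ j)"
  using assms
proof (induction N arbitrary: m)
  case 0
  then show ?case by simp
next
  case (Suc N)
  have "0 \<le> m div 3" "m div 3 < 3 ^ N"
    using Suc.prems by auto
  then have "m div 3 = (\<Sum>j<N. ternary_digit (m div 3) j * 3 ^ j)"
    by (rule Suc.IH)
  also have "\<dots> = (\<Sum>j<N. ternary_digit m (Suc j) * 3 ^ j)"
    by (simp add: ternary_digit_def zdiv_zmult2_eq)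
  finally have "3 * (m div 3) = (\<Sum>j<N. ternary_digit m (Suc j) * 3 ^ Suc j)"
    by (simp add: sum_distrib_left mult_ac)
  moreover have "m = ternary_digit m 0 + 3 * (m div 3)"
    by (simp add: ternary_digit_def)
  ultimately show ?case
    by (simp add: sum.lessThan_Suc_shift del: sum.lessThan_Suc)
qed

(* Intended for nonnegative m. *)
definition omits_digit_two :: "int \<Rightarrow> bool"
  where "omits_digit_two m \<longleftrightarrow> (\<forall>j. ternary_digit m j \<in> {0, 1})"

definition Sigma_set :: "int set \<Rightarrow> real set"
  where "Sigma_set S = {l. l > 0 \<and> (\<forall>n\<in>S. omits_digit_two \<lfloor>l * 2 powi n\<rfloor>)}"

end

theory Submission
  imports Defs "HOL-Analysis.Kronecker_Approximation_Theorem"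
begin

text \<open>
  If \<open>2 ^ d\<close> is sufficiently close to \<open>3 ^ N\<close>, then every integer \<open>m < 2 ^ s\<close> omitting the digit 2 has
  the two successors \<open>m * 3 ^ N + 3 ^ (N - 1) + b\<close> with \<open>b \<in> {0, 1}\<close>, which omit the digit 2 and
  lie in \<open>[m * 2 ^ d, (m + 1) * 2 ^ d)\<close>; the digit 1 after those of \<open>m\<close> keeps them away from both ends,
  so the sign of \<open>2 ^ d - 3 ^ N\<close> is irrelevant. Since \<open>d\<close> does not depend on \<open>m\<close>, iterating yields a
  binary tree of nested dyadic intervals, whose branches are distinct elements of \<open>Sigma_set\<close>.
  Dirichlet's theorem supplies \<open>d\<close> and \<open>N\<close>; replacing an approximation by a multiple of it makes
  \<open>d\<close> as large as required without any irrationality measure for \<open>ln 2 / ln 3\<close>.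
\<close>

section \<open>Powers of 2 close to powers of 3\<close>

lemma abs_exp_minus_one_le:
  fixes y :: real
  assumes "\<bar>y\<bar> \<le> 1 / 2"
  shows "\<bar>exp y - 1\<bar> \<le> 2 * \<bar>y\<bar>"
proof -
  have "exp y \<le> 1 + 2 * \<bar>y\<bar>"
    using exp_bound_lemma[of y] assms by simp
  moreover have "1 + y \<le> exp y" by (rule exp_ge_add_one_self)
  ultimately show ?thesis by linarith
qed

text \<open>Dirichlet's theorem with denominator bound \<open>4 * L * Q\<close> gives
  \<open>k\<close>, \<open>h\<close>; scaling both by \<open>L\<close> forces \<open>d\<close> to be
  at least \<open>L\<close> and multiplies the error only by \<open>L\<close>. As ln 3 \<le> 2, the
  numbers d ln 2 and N ln 3 then differ by at most 1 / (2Q), and exponentiating costs a factor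
  2.\<close>

lemma power_two_close_to_power_three:
  fixes L Q :: nat
  assumes "0 < L" "0 < Q"
  obtains d N where "L \<le> d" "d \<le> 4 * L\<^sup>2 * Q" "real Q * \<bar>2 ^ d - 3 ^ N\<bar> \<le> 3 ^ N"
proof -
  define \<theta> where "\<theta> = ln 2 / ln (3::real)"
  have \<theta>: "0 < \<theta>" "ln 2 = \<theta> * ln 3" by (auto simp: \<theta>_def)
  have pos: "0 < 4 * L * Q" using assms by simp
  obtain h k :: int where k: "0 < k" "k \<le> int (4 * L * Q)"
    and hk: "\<bar>of_int k * \<theta> - of_int h\<bar> < 1 / real (4 * L * Q)"
    by (rule Dirichlet_approx[OF pos])
  \<comment> \<open>An error below 1 with \<open>k * \<theta>\<close> positive rules out negative
    \<open>h\<close>, so that \<open>nat h\<close> loses nothing.\<close>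
  have "1 / real (4 * L * Q) \<le> 1" using assms by (simp add: field_simps flip: of_nat_mult)
  moreover have "0 < of_int k * \<theta>" using k \<theta> by simp
  ultimately have "of_int h > (-1::real)" using hk by linarith
  then have h: "0 \<le> h" by linarith
  define d where "d = L * nat k"
  define N where "N = L * nat h"
  define y where "y = real d * ln 2 - real N * ln 3"
  have "y = real L * ln 3 * (of_int k * \<theta> - of_int h)"
    using k h by (simp add: y_def d_def N_def \<theta>(2) algebra_simps)
  then have "\<bar>y\<bar> = real L * ln 3 * \<bar>of_int k * \<theta> - of_int h\<bar>" by (simp add: abs_mult)
  also have "\<dots> \<le> real L * ln 3 * (1 / real (4 * L * Q))"
    using hk by (intro mult_left_mono) auto
  also have "\<dots> = ln 3 / (4 * real Q)" using assms by simp
  also have "\<dots> \<le> 2 / (4 * real Q)"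
  proof -
    have "ln 3 \<le> (2::real)" using ln_le_minus_one[of "3::real"] by simp
    then show ?thesis by (intro divide_right_mono) auto
  qed
  finally have y: "\<bar>y\<bar> \<le> 1 / (2 * real Q)" by simp
  also have "\<dots> \<le> 1 / 2" using assms by (simp add: field_simps)
  finally have "\<bar>exp y - 1\<bar> \<le> 2 * \<bar>y\<bar>" by (rule abs_exp_minus_one_le)
  with y have "\<bar>exp y - 1\<bar> \<le> 1 / real Q" by (simp add: field_simps)
  moreover have "exp y = 2 ^ d / 3 ^ N"
    by (simp add: y_def exp_diff exp_of_nat_mult)
  then have "exp y - 1 = (2 ^ d - 3 ^ N) / 3 ^ N" by (simp add: diff_divide_distrib)
  then have "\<bar>exp y - 1\<bar> = \<bar>2 ^ d - 3 ^ N\<bar> / 3 ^ N" by (simp add: abs_divide)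
  ultimately have "real Q * \<bar>2 ^ d - 3 ^ N\<bar> \<le> 3 ^ N"
    using assms by (simp add: field_simps)
  moreover have "1 \<le> nat k" "nat k \<le> 4 * L * Q" using k by (simp_all add: nat_le_iff)
  then have "L \<le> d" "d \<le> 4 * L\<^sup>2 * Q"
    using assms by (auto simp: d_def power2_eq_square mult.assoc mult.left_commute)
  ultimately show thesis using that by blast
qed

section \<open>Ternary extensions inside dyadic intervals\<close>

lemma omits_digit_two_append:
  assumes "omits_digit_two m" "c \<in> {0, 1}"
  shows "omits_digit_two (3 * m + c)"
proof -
  have "ternary_digit (3 * m + c) j \<in> {0, 1}" for j
  proof (cases j)
    case 0
    then show ?thesis using assms(2) by (auto simp: ternary_digit_def)
  next
    case (Suc i)
    have "(3 * m + c) div 3 = m" using assms(2) by auto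
    then have "ternary_digit (3 * m + c) j = ternary_digit m i"
      by (simp add: Suc ternary_digit_def zdiv_zmult2_eq)
    then show ?thesis using assms(1) by (simp add: omits_digit_two_def)
  qed
  then show ?thesis by (simp add: omits_digit_two_def)
qed

lemma omits_digit_two_shift: "omits_digit_two m \<Longrightarrow> omits_digit_two (3 ^ t * m)"
proof (induction t)
  case (Suc t)
  then show ?case using omits_digit_two_append[of "3 ^ t * m" 0] by (simp add: mult.assoc)
qed simp

text \<open>The digits of \<open>m\<close> are followed by 1, then \<open>t\<close> zeros, then
  \<open>b\<close>. This is the successor of the overview with \<open>N = t + 2\<close>, in Horner
  form so that the digit lemmas apply one factor at a time.\<close>

definition extend_ternary :: "nat \<Rightarrow> bool \<Rightarrow> int \<Rightarrow> int"
  where "extend_ternary t b m = 3 * (3 ^ t * (3 * m + 1)) + of_bool b"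

lemma omits_digit_two_extend_ternary:
  "omits_digit_two m \<Longrightarrow> omits_digit_two (extend_ternary t b m)"
  unfolding extend_ternary_def
  by (intro omits_digit_two_append omits_digit_two_shift) auto

text \<open>Write \<open>2 ^ d = 9 * A + D\<close> with \<open>A = 3 ^ t\<close>. Both
  \<open>m\<close> and \<open>m + 1\<close> lie in [0, 2^s], so the factor
  \<open>2 ^ (s + 2)\<close> in \<open>close\<close> keeps \<open>m * D\<close> and
  \<open>(m + 1) * D\<close> within 9A/4. The inserted digit 1 contributes 3A, which exceeds this at
  the left end and leaves room at the right end.\<close>

lemma extend_ternary_in_interval:
  fixes m :: int
  assumes m: "0 \<le> m" "m + 1 \<le> 2 ^ s"
    and close: "real (2 ^ (s + 2)) * \<bar>2 ^ d - 3 ^ (t + 2)\<bar> \<le> 3 ^ (t + 2)"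
  shows "m * 2 ^ d \<le> extend_ternary t b m"
    and "extend_ternary t b m + 1 < (m + 1) * 2 ^ d"
proof -
  define A :: real where "A = 3 ^ t"
  define D :: real where "D = 2 ^ d - 9 * A"
  have A: "1 \<le> A" by (simp add: A_def)
  have D: "2 ^ d = 9 * A + D" by (simp add: D_def)
  have D4: "4 * (2 ^ s * \<bar>D\<bar>) \<le> 9 * A"
    using close by (simp add: D_def A_def power_add mult_ac)
  have small: "4 * \<bar>x * D\<bar> \<le> 9 * A" if "0 \<le> x" "x \<le> 2 ^ s" for x :: real
  proof -
    have "\<bar>x * D\<bar> \<le> 2 ^ s * \<bar>D\<bar>"
      using that by (simp add: abs_mult mult_right_mono)
    with D4 show ?thesis by linarith
  qed
  have "real_of_int (m + 1) \<le> real_of_int (2 ^ s)" using m(2) by (simp only: of_int_le_iff)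
  then have ms: "real_of_int m + 1 \<le> 2 ^ s" by simp
  have ext: "real_of_int (extend_ternary t b m) = m * (9 * A) + 3 * A + of_bool b"
    by (simp add: extend_ternary_def A_def algebra_simps)
  have "4 * \<bar>m * D\<bar> \<le> 9 * A" by (intro small) (use m(1) ms in linarith)+
  moreover have "0 \<le> (of_bool b :: real)" by simp
  ultimately have "m * D \<le> 3 * A + of_bool b" using A by linarith
  then have "real_of_int (m * 2 ^ d) \<le> real_of_int (extend_ternary t b m)"
    unfolding ext by (simp add: D algebra_simps)
  then show "m * 2 ^ d \<le> extend_ternary t b m" by (simp only: of_int_le_iff)
  have "4 * \<bar>(m + 1) * D\<bar> \<le> 9 * A" by (intro small) (use m(1) ms in linarith)+
  \<comment> \<open>The right side is at least 27A/4, while 3A + 2 \<le> 5A because A \<ge>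
    1.\<close>
  then have gap: "3 * A + 2 < 9 * A + (m + 1) * D" using A by linarith
  have "real_of_int (extend_ternary t b m + 1) \<le> m * (9 * A) + 3 * A + 2"
    by (simp add: ext)
  also have "\<dots> < (m + 1) * (9 * A) + (m + 1) * D"
    using gap by (simp add: algebra_simps)
  also have "\<dots> = real_of_int ((m + 1) * 2 ^ d)" by (simp add: D algebra_simps)
  finally show "extend_ternary t b m + 1 < (m + 1) * 2 ^ d" by (simp only: of_int_less_iff)
qed

section \<open>Limits of branches and uncountability\<close>

text \<open>The supremum of the left endpoints lies in all the closed intervals. Strictness in
  \<open>upper\<close> makes the right endpoints decrease strictly, so the supremum never equals one
  of them and the floors are exact.\<close>

lemma nested_dyadic_intervals:
  fixes m :: "nat \<Rightarrow> int" and s d :: "nat \<Rightarrow> nat"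
  assumes s: "\<And>k. s (Suc k) = s k + d k"
    and lower: "\<And>k. m k * 2 ^ d k \<le> m (Suc k)"
    and upper: "\<And>k. m (Suc k) + 1 < (m k + 1) * 2 ^ d k"
  obtains l :: real where "\<And>k. \<lfloor>l * 2 ^ s k\<rfloor> = m k"
proof -
  define x :: "nat \<Rightarrow> real" where "x k = m k / 2 ^ s k" for k
  define y :: "nat \<Rightarrow> real" where "y k = (m k + 1) / 2 ^ s k" for k
  have x: "x k \<le> x (Suc k)" for k
  proof -
    have "real_of_int (m k * 2 ^ d k) \<le> real_of_int (m (Suc k))" using lower[of k] by (simp only: of_int_le_iff)
    then show ?thesis by (simp add: x_def s power_add field_simps)
  qed
  have y: "y (Suc k) < y k" for k
  proof -
    have "real_of_int (m (Suc k) + 1) < real_of_int ((m k + 1) * 2 ^ d k)"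
      using upper[of k] by (simp only: of_int_less_iff)
    then have "y (Suc k) < (m k + 1) * 2 ^ d k / 2 ^ s (Suc k)"
      unfolding y_def by (intro divide_strict_right_mono) auto
    also have "\<dots> = y k" by (simp add: y_def s power_add)
    finally show ?thesis .
  qed
  have xy: "x i \<le> y j" for i j
  proof -
    have "x i \<le> x (max i j)" by (rule lift_Suc_mono_le[of x, OF x]) simp
    also have "\<dots> \<le> y (max i j)" by (simp add: x_def y_def divide_right_mono)
    also have "\<dots> \<le> y j" by (rule lift_Suc_antimono_le[of y, OF less_imp_le[OF y]]) simp
    finally show ?thesis .
  qed
  define l where "l = (SUP i. x i)"
  have "\<lfloor>l * 2 ^ s k\<rfloor> = m k" for k
  proof -
    have "bdd_above (range x)" by (rule bdd_aboveI[of _ "y 0"]) (use xy in blast)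
    then have "x k \<le> l" unfolding l_def by (intro cSUP_upper) auto
    moreover have "l \<le> y (Suc k)" unfolding l_def using xy by (intro cSUP_least) auto
    with y[of k] have "l < y k" by linarith
    ultimately show ?thesis
      by (intro floor_unique) (auto simp: x_def y_def field_simps)
  qed
  then show thesis using that by blast
qed

text \<open>Branches are indexed by sets \<open>B\<close> of levels, the final digit appended at
  level \<open>k\<close> recording whether \<open>k \<in> B\<close>. The exponents depend on the
  level only, so one set of integers serves all branches.\<close>

lemma uncountable_Sigma_set:
  fixes s d t :: "nat \<Rightarrow> nat"
  assumes s0: "0 < s 0" and s: "\<And>k. s (Suc k) = s k + d k"
    and close: "\<And>k. real (2 ^ (s k + 2)) * \<bar>2 ^ d k - 3 ^ (t k + 2)\<bar> \<le> 3 ^ (t k + 2)"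
  shows "uncountable (Sigma_set (range (\<lambda>k. int (s k))))"
proof -
  define m where "m B = rec_nat (1::int) (\<lambda>k. extend_ternary (t k) (k \<in> B))" for B
  have m0: "m B 0 = 1" and mS: "m B (Suc k) = extend_ternary (t k) (k \<in> B) (m B k)" for B k
    by (simp_all add: m_def)
  have omits: "omits_digit_two (m B k)" for B k
  proof (induction k)
    case 0
    have "omits_digit_two 0" by (simp add: omits_digit_two_def ternary_digit_def)
    then show ?case using omits_digit_two_append[of 0 1] by (simp add: m0)
  next
    case (Suc k)
    then show ?case by (simp add: mS omits_digit_two_extend_ternary)
  qed
  have bounds: "0 < m B k \<and> m B k + 1 \<le> 2 ^ s k" for B k
  proof (induction k)
    case 0
    have "(2::int) ^ 1 \<le> 2 ^ s 0" using s0 by (intro power_increasing) auto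
    then show ?case by (simp add: m0)
  next
    case (Suc k)
    have "m B (Suc k) + 1 \<le> (m B k + 1) * 2 ^ d k"
      using extend_ternary_in_interval(2)[OF _ _ close] Suc by (simp add: mS less_imp_le)
    also have "\<dots> \<le> 2 ^ s k * 2 ^ d k" using Suc by (intro mult_right_mono) auto
    finally have "m B (Suc k) + 1 \<le> 2 ^ s (Suc k)" by (simp add: s power_add)
    moreover have "0 < m B (Suc k)" using Suc
      by (auto simp: mS extend_ternary_def intro!: add_pos_nonneg)
    ultimately show ?case by simp
  qed
  have "\<exists>l::real. \<forall>k. \<lfloor>l * 2 ^ s k\<rfloor> = m B k" for B
  proof -
    have "m B k * 2 ^ d k \<le> m B (Suc k)" "m B (Suc k) + 1 < (m B k + 1) * 2 ^ d k" for k
      using extend_ternary_in_interval[OF _ _ close, of "m B k" k] bounds[of B k]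
      by (auto simp: mS)
    then show ?thesis using nested_dyadic_intervals[of s d "m B", OF s] by metis
  qed
  then obtain l :: "nat set \<Rightarrow> real" where l: "\<And>B k. \<lfloor>l B * 2 ^ s k\<rfloor> = m B k" by metis
  have "l B \<in> Sigma_set (range (\<lambda>k. int (s k)))" for B
  proof -
    \<comment> \<open>The root value 1, rather than 0, is what makes the real number
      positive.\<close>
    have "0 < \<lfloor>l B * 2 ^ s 0\<rfloor>" using l m0 by simp
    then have "0 < l B * 2 ^ s 0" by linarith
    then have "0 < l B" by (simp add: zero_less_mult_iff)
    then show ?thesis using l omits by (auto simp: Sigma_set_def)
  qed
  moreover have "inj l"
  proof (rule injI)
    fix B C assume "l B = l C"
    then have eq: "m B k = m C k" for k by (metis l)
    \<comment> \<open>With equal values at level \<open>k\<close>, equality at the next level leaves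
      only the appended final digits to compare.\<close>
    have "k \<in> B \<longleftrightarrow> k \<in> C" for k
      using eq[of k] eq[of "Suc k"] by (simp add: mS extend_ternary_def of_bool_eq_iff)
    then show "B = C" by blast
  qed
  moreover have "uncountable (UNIV :: nat set set)"
    using Cantors_theorem[of "UNIV :: nat set"] by (simp add: uncountable_def)
  ultimately show ?thesis
    using countable_image_inj_eq[of l UNIV] countable_subset[of "range l"] by blast
qed

section \<open>Choice of exponents and growth bounds\<close>

theorem theorem1p2:
  "\<exists>n :: nat \<Rightarrow> int.
     infinite (n ` {1..}) \<and>
     n 1 = 2 \<and>
     (\<forall>k\<ge>2. 2 powr (1 / 14 * (real_of_int (n (k - 1)) + 2 * real k - 7)) \<le> real_of_int (n k) \<and>
            real_of_int (n k) \<le> 2 powr (27 * (real_of_int (n (k - 1)) + 2 * real k + 6))) \<and>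
     uncountable (Sigma_set (n ` {1..}))"
proof -
  have "\<exists>d t. 2 ^ (s + 2 * j + 4) \<le> d \<and> d \<le> 2 ^ (3 * s + 4 * j + 12) \<and>
          real (2 ^ (s + 2)) * \<bar>2 ^ d - 3 ^ (t + 2)\<bar> \<le> 3 ^ (t + 2)" for s j :: nat
  proof -
    \<comment> \<open>\<open>?L\<close> provides the growth, \<open>?Q\<close> the closeness
      required by the interval lemma.\<close>
    let ?L = "2 ^ (s + 2 * j + 4) :: nat" and ?Q = "2 ^ (s + 2) :: nat"
    obtain d N where d: "?L \<le> d" "d \<le> 4 * ?L\<^sup>2 * ?Q"
      and N: "real ?Q * \<bar>2 ^ d - 3 ^ N\<bar> \<le> 3 ^ N"
      by (rule power_two_close_to_power_three[of ?L ?Q]) auto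
    have "4 * (2 ^ a)\<^sup>2 * 2 ^ b = (2::nat) ^ (2 + a * 2 + b)" for a b :: nat
      by (simp add: power_add power_mult)
    also have "2 + (s + 2 * j + 4) * 2 + (s + 2) = 3 * s + 4 * j + 12" by simp
    finally have "4 * ?L\<^sup>2 * ?Q = 2 ^ (3 * s + 4 * j + 12)" .
    with d have d_le: "d \<le> 2 ^ (3 * s + 4 * j + 12)" by simp
    \<comment> \<open>An extension appends at least two digits, so N \<ge> 2 is needed: 16 \<le> 2^d
      \<le> 2 * 3^N gives 3^N \<ge> 8.\<close>
    have "(2::nat) ^ 2 \<le> ?L" by (intro power_increasing) auto
    from order_trans[OF this d(1)] have "4 \<le> d" by simp
    then have "(2::real) ^ 4 \<le> 2 ^ d" by (intro power_increasing) auto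
    moreover have "\<bar>2 ^ d - 3 ^ N\<bar> \<le> (3::real) ^ N"
    proof -
      have "1 \<le> real ?Q" unfolding of_nat_power by (rule one_le_power) simp
      then have "1 * \<bar>2 ^ d - (3::real) ^ N\<bar> \<le> real ?Q * \<bar>2 ^ d - 3 ^ N\<bar>"
        by (intro mult_right_mono) auto
      from order_trans[OF this N] show ?thesis by (simp only: mult_1)
    qed
    ultimately have "(3::real) ^ 1 < 3 ^ N" by auto
    then have "1 < N" by (rule power_less_imp_less_exp[rotated]) auto
    then have "N = (N - 2) + 2" by simp
    then obtain t where "N = t + 2" by blast
    with d(1) d_le N show ?thesis by blast
  qed
  then obtain D T where D: "\<And>s j. 2 ^ (s + 2 * j + 4) \<le> D s j"
      "\<And>s j. D s j \<le> 2 ^ (3 * s + 4 * j + 12)"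
    and T: "\<And>s j. real (2 ^ (s + 2)) * \<bar>2 ^ D s j - 3 ^ (T s j + 2)\<bar> \<le> 3 ^ (T s j + 2)"
    by metis
  define s where "s = rec_nat (2::nat) (\<lambda>j s. s + D s j)"
  have s0: "s 0 = 2" and sS: "s (Suc j) = s j + D (s j) j" for j
    by (simp_all add: s_def)
  have "0 < D a j" for a j
    using D(1)[where s = a and j = j] by (metis less_le_trans zero_less_numeral zero_less_power)
  then have "strict_mono s" by (simp add: strict_mono_Suc_iff sS)
  then have inj: "inj (\<lambda>j. int (s j))"
    using strict_mono_imp_inj_on[of s UNIV] by (simp add: inj_def)
  \<comment> \<open>Shifts the index, since the required sequence starts at 1 and \<open>s\<close>
    at 0.\<close>
  define n where "n k = int (s (k - 1))" for k
  have "n ` {1..} = (\<lambda>j. int (s j)) ` ((\<lambda>k. k - 1) ` {1..})"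
    by (simp add: n_def image_image)
  also have "(\<lambda>k. k - 1) ` {1..} = (UNIV :: nat set)"
    by (auto intro!: image_eqI[of _ _ "Suc _"])
  finally have range: "n ` {1..} = range (\<lambda>j. int (s j))" .
  show ?thesis
  proof (intro exI[of _ n] conjI)
    show "uncountable (Sigma_set (n ` {1..}))"
      unfolding range using s0 sS T by (intro uncountable_Sigma_set[of s "\<lambda>j. D (s j) j" "\<lambda>j. T (s j) j"]) auto
    show "\<forall>k\<ge>2. 2 powr (1 / 14 * (real_of_int (n (k - 1)) + 2 * real k - 7)) \<le> real_of_int (n k) \<and>
            real_of_int (n k) \<le> 2 powr (27 * (real_of_int (n (k - 1)) + 2 * real k + 6))"
    proof (intro allI impI)
      fix k :: nat
      assume "k \<ge> 2"
      then have "k = (k - 2) + 2" by simp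
      then obtain j where k: "k = j + 2" by blast
      have nk: "real_of_int (n k) = real (s (Suc j))" and nk1: "real_of_int (n (k - 1)) = real (s j)"
        by (simp_all add: n_def k)
      \<comment> \<open>With k = j + 2 the left exponent is (s_j + 2j - 3) / 14, well below s_j + 2j
        + 4.\<close>
      have "2 powr (1 / 14 * (real (s j) + 2 * real k - 7)) \<le> 2 powr real (s j + 2 * j + 4)"
        by (intro powr_mono) (auto simp: k)
      also have "\<dots> = real (2 ^ (s j + 2 * j + 4))"
        unfolding of_nat_power of_nat_numeral by (rule powr_realpow) simp
      also have "\<dots> \<le> real (s (Suc j))"
        using D(1)[where s = "s j" and j = j] by (simp only: of_nat_le_iff sS)
      finally have lower: "2 powr (1 / 14 * (real (s j) + 2 * real k - 7)) \<le> real (s (Suc j))" .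
      let ?e = "3 * s j + 4 * j + 12"
      \<comment> \<open>Both summands of \<open>s (Suc j)\<close> are at most \<open>2 ^ ?e\<close>,
        so the sum costs one more in the exponent; 3 s_j + 4j + 13 is still below 27 (s_j + 2j +
        10).\<close>
      have "s j \<le> 2 ^ s j" by (rule less_imp_le[OF less_exp])
      also have "\<dots> \<le> 2 ^ ?e" by (intro power_increasing) auto
      finally have "s (Suc j) \<le> 2 ^ ?e + 2 ^ ?e"
        unfolding sS using D(2)[where s = "s j" and j = j] by (rule add_mono)
      also have "\<dots> = 2 ^ Suc ?e" by (simp only: power_Suc mult_2)
      finally have "s (Suc j) \<le> 2 ^ Suc ?e" .
      then have "real (s (Suc j)) \<le> real (2 ^ Suc ?e)" by (rule of_nat_mono)
      also have "\<dots> = 2 powr real (Suc ?e)"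
        unfolding of_nat_power of_nat_numeral by (rule powr_realpow[symmetric]) simp
      also have "\<dots> \<le> 2 powr (27 * (real (s j) + 2 * real k + 6))"
        by (intro powr_mono) (auto simp: k)
      finally show "2 powr (1 / 14 * (real_of_int (n (k - 1)) + 2 * real k - 7)) \<le> real_of_int (n k) \<and>
              real_of_int (n k) \<le> 2 powr (27 * (real_of_int (n (k - 1)) + 2 * real k + 6))"
        using lower by (simp only: nk nk1)
    qed
    show "infinite (n ` {1..})" unfolding range using inj by (rule range_inj_infinite)
    show "n 1 = 2" by (simp add: n_def s0)
  qed
qed

end
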